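(* Let $\bar u=(\bar u_1,\dots,\bar u_{n-1})$, $\bar u_k=kh_1P$, be the uniphase steady solution of the system $$\ddot u_k-\frac1{h_1}\sigma(\Delta u_{k+1})+\frac1{h_1}\sigma(\Delta u_k)=\frac{\varepsilon}{h_1^2}\left(\dot u_{k+1}-2\dot u_k+\dot u_{k-1}\right),\qquad k=1,\dots,n-1,$$ with $u_0=0$, $u_n=P$. If $P\in(\overline{\alpha},\underline{\beta})$, then $\bar u$ is hyperbolic, and so it is unstable.
   Context: $P>0$, $\varepsilon\in\mathbb{R}$, and $n\ge 2$ is an integer with $h_1=1/n$. The unknowns are functions $u_1(t),\dots,u_{n-1}(t)$; $u_0(t)=0$ and $u_n(t)=P$ for all $t$ (so $\dot u_0=\dot u_n=0$), and $\Delta u_k=\frac1{h_1}(u_k-u_{k-1})$ for $k=1,\dots,n$. The function $\sigma:\mathbb{R}\to\mathbb{R}$ is continuously differentiable, $\sigma(0)=0$, $\sigma(\xi)>0$ for $\xi>0$, $\sigma(\xi)<0$ for $\xi<0$. There are numbers $0<\underline{\alpha}<\overline{\alpha}<\underline{\beta}<\overline{\beta}$ such that $\sigma'(\xi)>0$ for $\xi\in(-\infty,\overline{\alpha})\cup(\underline{\beta},\infty)$, $\sigma'(\xi)<0$ for $\xi\in(\overline{\alpha},\underline{\beta})$, $\sigma(\underline{\alpha})=\sigma(\underline{\beta})$ and $\sigma(\overline{\alpha})=\sigma(\overline{\beta})$. Hyperbolicity and stability are understood for the equivalent first-order system in $(u,v)$, $v_k=\dot u_k$, at the equilibrium $(\bar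 u,0)$; hyperbolic means that the linearization there has no eigenvalue with zero real part. *)

theory Defs
  imports "HOL-Analysis.Analysis"
begin

definition solution_on :: "('a::real_normed_vector \<Rightarrow> 'a) \<Rightarrow> (real \<Rightarrow> 'a) \<Rightarrow> real set \<Rightarrow> bool" where
  "solution_on F x I \<longleftrightarrow> (\<forall>t\<in>I. (x has_vector_derivative F (x t)) (at t within I))"

text \<open>Lyapunov stability. Solutions need not be global in time, so we quantify over all
  solutions on all intervals [0,T); solutions on [0,\<open>\<infinity>\<close>) are covered by restriction.
  Consequently an unstable point has solutions that start arbitrarily close to it and actually
  leave a fixed neighbourhood.\<close>

definition lyapunov_stable :: "('a::real_normed_vector \<Rightarrow> 'a) \<Rightarrow> 'a \<Rightarrow> bool" where
  "lyapunov_stable F p \<longleftrightarrow>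
    (\<forall>\<epsilon>>0. \<exists>\<delta>>0. \<forall>T>0. \<forall>x. solution_on F x {0..<T} \<and> dist (x 0) p < \<delta> \<longrightarrow>
       (\<forall>t\<in>{0..<T}. dist (x t) p < \<epsilon>))"

definition unstable :: "('a::real_normed_vector \<Rightarrow> 'a) \<Rightarrow> 'a \<Rightarrow> bool" where
  "unstable F p \<longleftrightarrow> \<not> lyapunov_stable F p"

definition complex_eigenvalue :: "real^'k^'k \<Rightarrow> complex \<Rightarrow> bool" where
  "complex_eigenvalue A z \<longleftrightarrow>
    (\<exists>w::complex^'k. w \<noteq> 0 \<and> map_matrix complex_of_real A *v w = z *s w)"

definition hyperbolic_equilibrium :: "(real^'k \<Rightarrow> real^'k) \<Rightarrow> real^'k \<Rightarrow> bool" where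
  "hyperbolic_equilibrium F p \<longleftrightarrow>
    F p = 0 \<and> F differentiable (at p) \<and>
    (\<forall>z. complex_eigenvalue (jacobian F (at p)) z \<longrightarrow> Re z \<noteq> 0)"

text \<open>A state holds the n-1 displacements u\<open>\<^sub>1\<close>, \<open>\<dots>\<close>, u\<open>\<^sub>n\<^sub>-\<^sub>1\<close> in its \<^const>\<open>Inl\<close> coordinates and the
  n-1 velocities v\<open>\<^sub>k\<close> in its \<^const>\<open>Inr\<close> coordinates. Here \<open>'m\<close> is a type with n-1 elements and
  \<open>e\<close> is a numbering, i.e. a bijection from {1..<n} onto \<open>'m\<close>; the k-th mass is stored at \<open>e k\<close>.\<close>

definition displacement :: "nat \<Rightarrow> (nat \<Rightarrow> 'm) \<Rightarrow> real \<Rightarrow> real^('m::finite + 'm) \<Rightarrow> nat \<Rightarrow> real" where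
  "displacement n e P x k = (if k = 0 then 0 else if k = n then P else x $ Inl (e k))"

definition velocity :: "nat \<Rightarrow> (nat \<Rightarrow> 'm) \<Rightarrow> real^('m::finite + 'm) \<Rightarrow> nat \<Rightarrow> real" where
  "velocity n e x k = (if k = 0 \<or> k = n then 0 else x $ Inr (e k))"

definition strain :: "real \<Rightarrow> (nat \<Rightarrow> real) \<Rightarrow> nat \<Rightarrow> real" where
  "strain h u k = 1 / h * (u k - u (k - 1))"

definition second_order_eq ::
  "real \<Rightarrow> (real \<Rightarrow> real) \<Rightarrow> real \<Rightarrow> (nat \<Rightarrow> real) \<Rightarrow> (nat \<Rightarrow> real) \<Rightarrow> real \<Rightarrow> nat \<Rightarrow> bool" where
  "second_order_eq h \<sigma> \<epsilon> u v a k \<longleftrightarrow>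
    a - 1 / h * \<sigma> (strain h u (k + 1)) + 1 / h * \<sigma> (strain h u k)
      = \<epsilon> / h\<^sup>2 * (v (k + 1) - 2 * v k + v (k - 1))"

definition chain_field ::
  "nat \<Rightarrow> (nat \<Rightarrow> 'm) \<Rightarrow> real \<Rightarrow> (real \<Rightarrow> real) \<Rightarrow> real \<Rightarrow> real \<Rightarrow> real^('m::finite + 'm) \<Rightarrow> real^('m + 'm)"
  where
  "chain_field n e h \<sigma> \<epsilon> P x =
    (let u = displacement n e P x; v = velocity n e x in
      \<chi> i. case i of
        Inl j \<Rightarrow> x $ Inr j
      | Inr j \<Rightarrow> (let k = the_inv_into {1..<n} e j in
          1 / h * \<sigma> (strain h u (k + 1)) - 1 / h * \<sigma> (strain h u k)
            + \<epsilon> / h\<^sup>2 * (v (k + 1) - 2 * v k + v (k - 1))))"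

definition uniphase_state :: "nat \<Rightarrow> (nat \<Rightarrow> 'm) \<Rightarrow> real \<Rightarrow> real \<Rightarrow> real^('m::finite + 'm)" where
  "uniphase_state n e h P =
    (\<chi> i. case i of Inl j \<Rightarrow> real (the_inv_into {1..<n} e j) * h * P | Inr j \<Rightarrow> 0)"

text \<open>The first-order system is equivalent to the second-order one with boundary values
  u\<open>\<^sub>0\<close> = 0 and u\<open>\<^sub>n\<close> = P.\<close>

lemma solution_on_chain_field_iff:
  fixes e :: "nat \<Rightarrow> 'm::finite"
  assumes e: "bij_betw e {1..<n} UNIV"
  shows "solution_on (chain_field n e h \<sigma> \<epsilon> P) x I \<longleftrightarrow>
    (\<forall>t\<in>I. \<forall>k\<in>{1..<n}.
       ((\<lambda>s. displacement n e P (x s) k) has_real_derivative velocity n e (x t) k) (at t within I) \<and>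
       (\<exists>a. ((\<lambda>s. velocity n e (x s) k) has_real_derivative a) (at t within I) \<and>
            second_order_eq h \<sigma> \<epsilon> (displacement n e P (x t)) (velocity n e (x t)) a k))"
proof -
  have inv: "the_inv_into {1..<n} e (e k) = k" if "k \<in> {1..<n}" for k
    using e that by (auto simp: bij_betw_def intro: the_inv_into_f_f)
  have all: "(\<forall>j. Q j) \<longleftrightarrow> (\<forall>k\<in>{1..<n}. Q (e k))" for Q :: "'m \<Rightarrow> bool"
    using e by (auto simp: bij_betw_def) (metis UNIV_I imageE)
  have comp: "(x has_vector_derivative y) (at t within I) \<longleftrightarrow>
      (\<forall>i. ((\<lambda>s. x s $ i) has_real_derivative y $ i) (at t within I))" for y t
    unfolding has_real_derivative_iff_has_vector_derivative has_vector_derivative_def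
    by (subst has_derivative_componentwise_within) (simp add: Basis_vec_def inner_axis)
  let ?F = "chain_field n e h \<sigma> \<epsilon> P"
  have "((\<forall>j. ((\<lambda>s. x s $ Inl j) has_real_derivative ?F (x t) $ Inl j) (at t within I)) \<and>
         (\<forall>j. ((\<lambda>s. x s $ Inr j) has_real_derivative ?F (x t) $ Inr j) (at t within I))) \<longleftrightarrow>
    (\<forall>k\<in>{1..<n}.
       ((\<lambda>s. displacement n e P (x s) k) has_real_derivative velocity n e (x t) k) (at t within I) \<and>
       (\<exists>a. ((\<lambda>s. velocity n e (x s) k) has_real_derivative a) (at t within I) \<and>
            second_order_eq h \<sigma> \<epsilon> (displacement n e P (x t)) (velocity n e (x t)) a k))" for t
    unfolding all ball_conj_distrib[symmetric]
  proof (intro ball_cong refl)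
    fix k assume k: "k \<in> {1..<n}"
    let ?u = "displacement n e P (x t)" and ?v = "velocity n e (x t)"
    let ?a = "1 / h * \<sigma> (strain h ?u (k + 1)) - 1 / h * \<sigma> (strain h ?u k)
                + \<epsilon> / h\<^sup>2 * (?v (k + 1) - 2 * ?v k + ?v (k - 1))"
    have "(\<lambda>s. displacement n e P (x s) k) = (\<lambda>s. x s $ Inl (e k))"
      and v: "velocity n e y k = y $ Inr (e k)" for y
      using k by (auto simp: displacement_def velocity_def)
    moreover have "?F (x t) $ Inl (e k) = ?v k"
      by (simp add: chain_field_def v Let_def)
    moreover have "?F (x t) $ Inr (e k) = ?a"
      by (simp only: chain_field_def Let_def vec_lambda_beta sum.case inv[OF k])
    moreover have "second_order_eq h \<sigma> \<epsilon> ?u ?v a k \<longleftrightarrow> a = ?a" for a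
      unfolding second_order_eq_def by linarith
    ultimately show "((\<lambda>s. x s $ Inl (e k)) has_real_derivative ?F (x t) $ Inl (e k)) (at t within I) \<and>
        ((\<lambda>s. x s $ Inr (e k)) has_real_derivative ?F (x t) $ Inr (e k)) (at t within I) \<longleftrightarrow>
        ((\<lambda>s. displacement n e P (x s) k) has_real_derivative ?v k) (at t within I) \<and>
        (\<exists>a. ((\<lambda>s. velocity n e (x s) k) has_real_derivative a) (at t within I) \<and>
          second_order_eq h \<sigma> \<epsilon> ?u ?v a k)"
      by (simp add: v)
  qed
  then show ?thesis
    unfolding solution_on_def comp split_sum_all by blast
qed

lemma uniphase_state_components:
  fixes e :: "nat \<Rightarrow> 'm::finite"
  assumes e: "bij_betw e {1..<n} UNIV" and h: "h = 1 / real n" and n: "n > 0" and k: "k \<le> n"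
  shows "displacement n e P (uniphase_state n e h P) k = real k * h * P"
    and "velocity n e (uniphase_state n e h P) k = 0"
proof -
  have inv: "the_inv_into {1..<n} e (e k) = k" if "k \<noteq> 0" "k \<noteq> n"
    using e k that by (auto simp: bij_betw_def intro!: the_inv_into_f_f)
  show "displacement n e P (uniphase_state n e h P) k = real k * h * P"
    using inv h n by (simp add: displacement_def uniphase_state_def)
  show "velocity n e (uniphase_state n e h P) k = 0"
    by (simp add: velocity_def uniphase_state_def)
qed

end

theory Submission
  imports Defs
begin

text \<open>Move the uniphase state to the origin and write a\<open>\<^sub>k\<close> for the displacements, b\<open>\<^sub>k\<close> for the
  velocities, d\<open>\<^sub>k\<close> for the strains of a perturbation and \<open>\<tau>\<close> d = \<open>\<sigma>\<close>(P + d) - \<open>\<sigma>\<close>(P) for the stress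
  increment. The proof rests on one quadratic form,
  \<open>V = 2 \<Sum> a\<^sub>k b\<^sub>k + \<epsilon> \<Sum> d\<^sub>k\<^sup>2\<close>.
  Differentiate \<open>\<Sum> a\<^sub>k b\<^sub>k\<close> along a solution and sum by parts: the viscous term contributes
  exactly minus the derivative of \<open>(\<epsilon>/2) \<Sum> d\<^sub>k\<^sup>2\<close>. The second summand of V therefore cancels it,
  for either sign of \<open>\<epsilon>\<close>, and \<open>V' = 2 (\<Sum> b\<^sub>k\<^sup>2 - \<Sum> d\<^sub>k \<tau>(d\<^sub>k))\<close>; this is \<open>chain_form_rate\<close>.
  Where \<open>\<sigma>' < 0\<close>, the increment \<open>\<tau>\<close> decreases near 0, so V' is bounded below by a positive
  multiple of \<open>\<Sum> b\<^sub>k\<^sup>2 + \<Sum> d\<^sub>k\<^sup>2\<close>; by the discrete Poincare inequality that sum is positive definite and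
  a multiple of it bounds V.

  Both claims follow. For the linearization A, with \<open>\<tau>\<close> d = \<open>\<sigma>\<close>'(P) d, the polarization B of V satisfies
  B(w, A w) > 0 for all w other than 0, and such a form excludes eigenvalues on the imaginary axis
  (\<open>no_imaginary_eigenvalue\<close>). For the nonlinear system, V' \<open>\<ge>\<close> \<open>\<kappa>\<close> V near the equilibrium
  with some \<open>\<kappa>\<close> > 0, and V is positive at points arbitrarily close to it; there V grows exponentially, so
  the solutions leave a fixed ball (\<open>quadratic_growth_imp_unstable\<close>).

  Instability in the sense of the definition asserts that escaping solutions exist. They are obtained
  from a globally Lipschitz modification of the field, for which the contraction principle yields
  solutions on intervals of any length (\<open>global_solution_of_lipschitz_field\<close>).\<close>

section \<open>Solutions of globally Lipschitz fields\<close>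

text \<open>Banach's fixed point theorem for the integral equation. On a long interval the integral operator
  need not contract in the supremum norm, but it does in Bielecki's weighted norm, the supremum of
  exp(- K t) |x(t)|. The weight is built in by taking f(t) = exp(- K t) x(t) as the unknown, and f is
  extended constantly outside [0, T] to be a bounded continuous function on the whole line.\<close>
lemma global_solution_of_lipschitz_field:
  fixes G :: "'a::banach \<Rightarrow> 'a"
  assumes lip: "L-lipschitz_on UNIV G" and T: "T \<ge> 0"
  obtains x where "x 0 = x0" "solution_on G x {0..T}"
proof -
  define K where "K = L + 1"
  have L: "L \<ge> 0" using lip by (rule lipschitz_on_nonneg)
  have K: "K > 0" and LK: "L / K < 1" using L by (auto simp: K_def)
  define cl where "cl t = max 0 (min T t)" for t :: real
  have cl: "cl t \<in> {0..T}" for t using T by (auto simp: cl_def)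
  have cl_id: "cl t = t" if "t \<in> {0..T}" for t using that by (auto simp: cl_def)
  have contG: "continuous_on S (\<lambda>s. G (g s))" if "continuous_on S g" for g :: "real \<Rightarrow> 'a" and S
    using continuous_on_compose2[OF lipschitz_on_continuous_on[OF lip] that] by auto
  define g where "g f s = G (exp (K * s) *\<^sub>R apply_bcontfun f s)" for f :: "real \<Rightarrow>\<^sub>C 'a" and s
  have cont_g: "continuous_on S (g f)" for S f
    unfolding g_def by (intro contG continuous_intros continuous_on_apply_bcontfun)
  have int_g: "g f integrable_on {a..b}" for a b f
    by (intro integrable_continuous_interval cont_g)
  define R where "R f t = x0 + integral {0..t} (g f)" for f t
  have cont_R: "continuous_on {0..T} (R f)" for f
    unfolding R_def by (intro continuous_intros indefinite_integral_continuous_1 int_g)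
  define \<Phi> where "\<Phi> f t = exp (- (K * cl t)) *\<^sub>R R f (cl t)" for f t
  have \<Phi>: "\<Phi> f \<in> bcontfun" for f
  proof -
    define q where "q t = exp (- (K * t)) *\<^sub>R R f t" for t
    have q: "continuous_on {0..T} q"
      unfolding q_def by (intro continuous_intros cont_R)
    have "continuous_on UNIV cl" unfolding cl_def by (intro continuous_intros)
    then have "continuous_on UNIV (\<lambda>t. q (cl t))"
      using continuous_on_compose2[OF q] cl by blast
    moreover have "range (\<lambda>t. q (cl t)) \<subseteq> q ` {0..T}" using cl by auto
    then have "bounded (range (\<lambda>t. q (cl t)))"
      using compact_imp_bounded[OF compact_continuous_image[OF q]] bounded_subset by blast
    ultimately show ?thesis by (simp add: bcontfun_def \<Phi>_def[abs_def] q_def)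
  qed
  have contraction: "dist (Bcontfun (\<Phi> f)) (Bcontfun (\<Phi> f')) \<le> L / K * dist f f'" for f f'
  proof (rule dist_bound)
    fix t0
    define t where "t = cl t0"
    have t: "t \<ge> 0" using cl[of t0] by (simp add: t_def)
    \<comment> \<open>integrating the weight gains the factor 1/K, and K = L + 1 makes L/K less than 1\<close>
    have ftc: "((\<lambda>s. L * dist f f' * exp (K * s)) has_integral
        L * dist f f' * exp (K * t) / K - L * dist f f' * exp (K * 0) / K) {0..t}"
      using K by (intro fundamental_theorem_of_calculus t)
        (auto intro!: derivative_eq_intros simp: has_real_derivative_iff_has_vector_derivative[symmetric])
    have "norm (integral {0..t} (\<lambda>s. g f s - g f' s)) \<le> integral {0..t} (\<lambda>s. L * dist f f' * exp (K * s))"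
    proof (rule integral_norm_bound_integral)
      show "(\<lambda>s. g f s - g f' s) integrable_on {0..t}" by (intro integrable_diff int_g)
      show "(\<lambda>s. L * dist f f' * exp (K * s)) integrable_on {0..t}" using ftc by blast
      fix s
      have "norm (g f s - g f' s) \<le> L * dist (exp (K * s) *\<^sub>R f s) (exp (K * s) *\<^sub>R f' s)"
        using lipschitz_onD[OF lip] by (simp add: g_def dist_norm)
      also have "\<dots> = L * (exp (K * s) * dist (f s) (f' s))"
        by (simp add: dist_norm scaleR_diff_right[symmetric])
      also have "\<dots> \<le> L * (exp (K * s) * dist f f')"
        by (intro mult_left_mono dist_bounded L) auto
      finally show "norm (g f s - g f' s) \<le> L * dist f f' * exp (K * s)" by (simp add: mult_ac)
    qed
    also have "\<dots> \<le> L * dist f f' * exp (K * t) / K"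
      unfolding integral_unique[OF ftc] using K L by simp
    finally have *: "norm (R f t - R f' t) \<le> L / K * dist f f' * exp (K * t)"
      by (simp add: R_def integral_diff int_g)
    have "dist (\<Phi> f t0) (\<Phi> f' t0) = exp (- (K * t)) * norm (R f t - R f' t)"
      by (simp add: \<Phi>_def dist_norm t_def scaleR_diff_right[symmetric])
    also have "\<dots> \<le> exp (- (K * t)) * (L / K * dist f f' * exp (K * t))"
      by (intro mult_left_mono *) auto
    also have "\<dots> = L / K * dist f f'" by (simp add: exp_minus)
    finally show "dist (Bcontfun (\<Phi> f) t0) (Bcontfun (\<Phi> f') t0) \<le> L / K * dist f f'"
      by (simp add: Bcontfun_inverse \<Phi>)
  qed
  obtain f where f: "Bcontfun (\<Phi> f) = f"
    using banach_fix_type[of "L / K" "\<lambda>f. Bcontfun (\<Phi> f)"] LK L K contraction by auto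
  have f_eq: "apply_bcontfun f t = exp (- (K * t)) *\<^sub>R R f t" if "t \<in> {0..T}" for t
  proof -
    have "apply_bcontfun f t = \<Phi> f t" using Bcontfun_inverse[OF \<Phi>, of f] f by simp
    then show ?thesis using that by (simp add: \<Phi>_def cl_id)
  qed
  have g_eq: "g f t = G (R f t)" if "t \<in> {0..T}" for t
    using f_eq[OF that] by (simp add: g_def exp_minus)
  have "(R f has_vector_derivative G (R f t)) (at t within {0..T})" if "t \<in> {0..T}" for t
    unfolding g_eq[OF that, symmetric] unfolding R_def
    by (rule has_vector_derivative_eq_rhs[OF has_vector_derivative_add[OF has_vector_derivative_const
          integral_has_vector_derivative[OF cont_g that]]]) simp
  then have "solution_on G (R f) {0..T}" by (simp add: solution_on_def)
  moreover have "R f 0 = x0" by (simp add: R_def)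
  ultimately show thesis using that by blast
qed

section \<open>Lipschitz estimates and real functions\<close>

lemma lipschitz_on_componentwise:
  fixes f :: "'a::metric_space \<Rightarrow> real^'k"
  assumes "\<And>i. \<exists>C. C-lipschitz_on X (\<lambda>x. f x $ i)"
  shows "\<exists>C. C-lipschitz_on X f"
proof -
  obtain C where C: "\<And>i. (C i)-lipschitz_on X (\<lambda>x. f x $ i)" using assms by metis
  have "(\<Sum>i\<in>UNIV. C i)-lipschitz_on X f"
  proof (rule lipschitz_onI)
    fix x y assume xy: "x \<in> X" "y \<in> X"
    have "dist (f x) (f y) \<le> (\<Sum>i\<in>UNIV. \<bar>(f x - f y) $ i\<bar>)"
      unfolding dist_norm by (rule norm_le_l1_cart)
    also have "\<dots> \<le> (\<Sum>i\<in>UNIV. C i * dist x y)"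
      using lipschitz_onD[OF C xy] by (intro sum_mono) (simp add: dist_real_def)
    finally show "dist (f x) (f y) \<le> (\<Sum>i\<in>UNIV. C i) * dist x y" by (simp add: sum_distrib_right)
  qed (intro sum_nonneg lipschitz_on_nonneg[OF C])
  then show ?thesis by blast
qed

lemma lipschitz_on_interval_if_C1:
  fixes f :: "real \<Rightarrow> real"
  assumes "\<And>x. x \<in> {a..b} \<Longrightarrow> (f has_real_derivative f' x) (at x)" and cont: "continuous_on {a..b} f'"
  shows "\<exists>C. C-lipschitz_on {a..b} f"
proof -
  obtain C where C: "C > 0" "\<And>x. x \<in> {a..b} \<Longrightarrow> norm (f' x) \<le> C"
    using compact_imp_bounded[OF compact_continuous_image[OF cont]] by (auto simp: bounded_pos)
  have "C-lipschitz_on {a..b} f"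
  proof (rule bounded_derivative_imp_lipschitz)
    show "(f has_derivative (*) (f' x)) (at x within {a..b})" if "x \<in> {a..b}" for x
      using assms(1)[OF that] by (auto simp: has_field_derivative_def intro: has_derivative_at_withinI)
    show "onorm ((*) (f' x)) \<le> C" if "x \<in> {a..b}" for x
      using C(2)[OF that] by (intro onorm_le) (simp add: abs_mult mult_right_mono)
  qed (use C in auto)
  then show ?thesis ..
qed

text \<open>Half the slope at 0 absorbs the remainder. With \<open>\<tau>\<close> the stress increment, this makes the
  elastic part of the rate of V positive definite in the strains, as long as they are small.\<close>
lemma negative_derivative_at_0_bound:
  fixes \<tau> :: "real \<Rightarrow> real"
  assumes "(\<tau> has_real_derivative c) (at 0)" "c < 0" "\<tau> 0 = 0"
  obtains \<rho> where "\<rho> > 0" "\<And>d. \<bar>d\<bar> \<le> \<rho> \<Longrightarrow> d * \<tau> d \<le> c / 2 * d\<^sup>2"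
proof -
  have "((\<lambda>d. \<tau> d / d) \<longlongrightarrow> c) (at 0)"
    using assms by (simp add: has_field_derivative_iff)
  then have "eventually (\<lambda>d. \<tau> d / d < c / 2) (at 0)"
    using assms(2) by (intro order_tendstoD) auto
  then obtain r where r: "r > 0" "\<And>d. d \<noteq> 0 \<Longrightarrow> dist d 0 < r \<Longrightarrow> \<tau> d / d < c / 2"
    unfolding eventually_at by auto
  show thesis
  proof (rule that[of "r / 2"])
    fix d :: real assume d: "\<bar>d\<bar> \<le> r / 2"
    show "d * \<tau> d \<le> c / 2 * d\<^sup>2"
    proof (cases "d = 0")
      case False
      then have "\<tau> d / d * d\<^sup>2 \<le> c / 2 * d\<^sup>2" using r d by (intro mult_right_mono less_imp_le) auto
      then show ?thesis using False by (simp add: power2_eq_square mult.commute)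
    qed simp
  qed (use r in auto)
qed

section \<open>Quadratic forms, instability and eigenvalues\<close>

text \<open>A Chetaev argument. With V(x) = B(x - p, x - p), the hypothesis on B(x - p, F x) gives
  V' \<open>\<ge>\<close> 2 c V along solutions inside the ball, so a solution that starts where V > 0 cannot
  stay in the ball, where V is bounded. If p were stable, then a solution from a point close to p would stay
  in the ball for as long as it exists; composing F with the projection onto the ball gives a
  globally Lipschitz field, whose solution exists long enough.\<close>
lemma quadratic_growth_imp_unstable:
  fixes F :: "'a::euclidean_space \<Rightarrow> 'a" and B :: "'a \<Rightarrow> 'a \<Rightarrow> real"
  assumes B: "bilinear B" and sym: "\<And>x y. B x y = B y x"
    and r: "r > 0" and lip: "L-lipschitz_on (cball p r) F" and c: "c > 0"
    and grow: "\<And>x. x \<in> cball p r \<Longrightarrow> B (x - p) (F x) \<ge> c * B (x - p) (x - p)"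
    and v: "B v v > 0"
  shows "unstable F p"
  unfolding unstable_def
proof
  assume "lyapunov_stable F p"
  then have "\<exists>\<delta>>0. \<forall>T>0. \<forall>x. solution_on F x {0..<T} \<and> dist (x 0) p < \<delta> \<longrightarrow>
      (\<forall>t\<in>{0..<T}. dist (x t) p < r / 2)"
    unfolding lyapunov_stable_def using half_gt_zero[OF r] by blast
  then obtain \<delta> where \<delta>: "\<delta> > 0" and stable: "\<And>T x t. T > 0 \<Longrightarrow> solution_on F x {0..<T} \<Longrightarrow>
      dist (x 0) p < \<delta> \<Longrightarrow> t \<in> {0..<T} \<Longrightarrow> dist (x t) p < r / 2"
    by blast
  have bb: "bounded_bilinear B" using B by (simp add: bilinear_conv_bounded_bilinear)
  interpret B: bounded_bilinear B by (rule bb)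
  have v0: "v \<noteq> 0" using v by (auto simp: B.zero_left)
  \<comment> \<open>scaling v brings the starting point within reach of stability and keeps V positive there\<close>
  define s where "s = min \<delta> (r / 2) / 2 / norm v"
  have s: "s > 0" using \<delta> r v0 by (simp add: s_def)
  have sv: "norm (s *\<^sub>R v) < \<delta>" "norm (s *\<^sub>R v) < r / 2" using v0 \<delta> r by (auto simp: s_def)
  define V0 where "V0 = B (s *\<^sub>R v) (s *\<^sub>R v)"
  have V0: "V0 > 0" using s v by (simp add: V0_def B.scaleR_left B.scaleR_right)
  obtain M where M: "\<And>x y. norm (B x y) \<le> norm x * norm y * M" "M \<ge> 0" using B.nonneg_bounded by blast
  \<comment> \<open>at time T the exponential lower bound for V exceeds its maximum on the ball\<close>
  obtain T where T: "T > 0" "V0 * exp (2 * c * T) > r * r * M"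
  proof -
    define T where "T = (r * r * M) / V0 / (2 * c) + 1"
    have Tp: "T > 0" unfolding T_def using r M V0 c by (intro add_nonneg_pos) auto
    have "r * r * M / V0 < 2 * c * T" using c by (simp add: T_def field_simps)
    also have "\<dots> < exp (2 * c * T)" using exp_ge_add_one_self[of "2 * c * T"] by linarith
    finally have "r * r * M < V0 * exp (2 * c * T)" using V0 by (simp add: field_simps)
    then show thesis using that Tp by blast
  qed
  \<comment> \<open>the projection onto the ball is nonexpansive, so G inherits the Lipschitz constant of F\<close>
  define G where "G x = F (closest_point (cball p r) x)" for x
  have "L-lipschitz_on UNIV G"
  proof (rule lipschitz_onI)
    fix x y
    have mem: "closest_point (cball p r) z \<in> cball p r" for z
      using r by (intro closest_point_in_set) auto
    have "dist (G x) (G y) \<le> L * dist (closest_point (cball p r) x) (closest_point (cball p r) y)"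
      unfolding G_def by (rule lipschitz_onD[OF lip mem mem])
    also have "\<dots> \<le> L * dist x y"
      using r by (intro mult_left_mono closest_point_lipschitz lipschitz_on_nonneg[OF lip]) auto
    finally show "dist (G x) (G y) \<le> L * dist x y" .
  qed (rule lipschitz_on_nonneg[OF lip])
  then obtain x where x0: "x 0 = p + s *\<^sub>R v" and x: "solution_on G x {0..T}"
    using global_solution_of_lipschitz_field T(1) less_imp_le by metis
  have GF: "G y = F y" if "dist y p \<le> r" for y
    using that by (simp add: G_def closest_point_self dist_commute)
  have dx: "(x has_vector_derivative G (x t)) (at t within {0..T})" if "t \<in> {0..T}" for t
    using x that by (simp add: solution_on_def)
  have cx: "continuous_on {0..T} x"
    using has_vector_derivative_continuous[OF dx] by (auto simp: continuous_on_eq_continuous_within)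
  have start: "dist (x 0) p < \<delta>" "dist (x 0) p < r / 2" using sv by (auto simp: x0 dist_norm)
  \<comment> \<open>until the first exit time x solves the original equation, so stability keeps it within r/2;
    by continuity it cannot be at distance r at that time\<close>
  have inside: "dist (x t) p < r" if t: "t \<in> {0..T}" for t
  proof (rule ccontr)
    assume "\<not> dist (x t) p < r"
    define S where "S = {0..T} \<inter> (\<lambda>t. dist (x t) p) -` {r..}"
    have "closed S" unfolding S_def
      by (intro continuous_closed_preimage continuous_intros cx)
    then have "compact S" unfolding S_def
      by (metis Int_lower1 bounded_closed_interval bounded_subset compact_eq_bounded_closed)
    moreover have "t \<in> S" using t \<open>\<not> dist (x t) p < r\<close> by (auto simp: S_def)
    ultimately obtain t1 where t1: "t1 \<in> S" "\<And>t. t \<in> S \<Longrightarrow> t1 \<le> t"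
      using compact_attains_inf[of S] by blast
    have t1T: "t1 \<in> {0..T}" "dist (x t1) p \<ge> r" using t1 by (auto simp: S_def)
    have pos: "t1 > 0" using start r t1T by (cases "t1 = 0") auto
    have before: "dist (x t) p \<le> r" if "t \<in> {0..<t1}" for t
      using t1(2)[of t] t1T that by (force simp: S_def)
    have "solution_on F x {0..<t1}"
      unfolding solution_on_def
    proof
      fix t assume t: "t \<in> {0..<t1}"
      have "(x has_vector_derivative G (x t)) (at t within {0..<t1})"
        using t t1T by (intro has_vector_derivative_within_subset[OF dx]) auto
      then show "(x has_vector_derivative F (x t)) (at t within {0..<t1})"
        using GF before[OF t] by simp
    qed
    note st = stable[OF pos this start(1)]
    have "continuous_on {0..t1} (\<lambda>t. dist (x t) p)"
      using t1T by (intro continuous_intros continuous_on_subset[OF cx]) auto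
    then obtain t2 where "0 \<le> t2" "t2 \<le> t1" "dist (x t2) p = 3 / 4 * r"
      using IVT'[of "\<lambda>t. dist (x t) p" 0 "3/4*r" t1] pos start r t1T by auto
    then show False using st[of t2] t1T r by (cases "t2 = t1") auto
  qed
  define q where "q t = exp (- (2 * c * t)) * B (x t - p) (x t - p)" for t
  have "q 0 \<le> q T"
  proof (rule DERIV_nonneg_imp_increasing_open[where f = q and a = 0 and b = T])
    show "continuous_on {0..T} q" unfolding q_def
      by (intro continuous_on_mult continuous_on_exp B.continuous_on continuous_on_diff continuous_intros cx)
    fix t assume t: "0 < t" "t < T"
    have d1: "((\<lambda>t. x t - p) has_vector_derivative F (x t)) (at t)"
      using dx[of t] t inside[of t] GF[of "x t"] by (auto simp: at_within_Icc_at intro!: derivative_eq_intros)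
    have "((\<lambda>t. B (x t - p) (x t - p)) has_real_derivative 2 * B (x t - p) (F (x t))) (at t)"
      using B.has_vector_derivative[OF d1 d1] sym[of "F (x t)"]
      by (simp add: has_real_derivative_iff_has_vector_derivative)
    then have "(q has_real_derivative exp (- (2 * c * t)) *
        (2 * (B (x t - p) (F (x t)) - c * B (x t - p) (x t - p)))) (at t)"
      unfolding q_def by (auto intro!: derivative_eq_intros simp: algebra_simps)
    moreover have "B (x t - p) (F (x t)) - c * B (x t - p) (x t - p) \<ge> 0"
      using grow[of "x t"] inside[of t] t by (simp add: dist_commute)
    ultimately show "\<exists>y. (q has_real_derivative y) (at t) \<and> 0 \<le> y" by (intro exI conjI) auto
  qed (use T in auto)
  then have "V0 * exp (2 * c * T) \<le> B (x T - p) (x T - p)"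
    by (simp add: q_def x0 V0_def[symmetric] exp_minus field_simps)
  also have "\<dots> \<le> norm (x T - p) * norm (x T - p) * M" using M(1)[of "x T - p" "x T - p"] by simp
  also have "\<dots> \<le> r * r * M"
    using inside[of T] T M(2) r by (intro mult_right_mono mult_mono) (auto simp: dist_norm)
  finally show False using T by simp
qed

text \<open>For an eigenvector x + i y with eigenvalue i \<open>\<eta>\<close>, A x = - \<open>\<eta>\<close> y and A y = \<open>\<eta>\<close> x, hence
  B(x, A x) + B(y, A y) = 0 by symmetry, against positivity. This is the easy half of Lyapunov's
  inertia theorem.\<close>
lemma no_imaginary_eigenvalue:
  fixes A :: "real^'k^'k" and B :: "real^'k \<Rightarrow> real^'k \<Rightarrow> real"
  assumes B: "bilinear B" and sym: "\<And>x y. B x y = B y x"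
    and pos: "\<And>x. x \<noteq> 0 \<Longrightarrow> B x (A *v x) > 0"
    and z: "complex_eigenvalue A z"
  shows "Re z \<noteq> 0"
proof
  assume Re: "Re z = 0"
  obtain w where w: "w \<noteq> 0" "map_matrix complex_of_real A *v w = z *s w"
    using z by (auto simp: complex_eigenvalue_def)
  define x y where "x = (\<chi> i. Re (w $ i))" and "y = (\<chi> i. Im (w $ i))"
  have eq: "(\<Sum>j\<in>UNIV. complex_of_real (A $ i $ j) * w $ j) = z * w $ i" for i
    using arg_cong[OF w(2), of "\<lambda>u. u $ i"]
    by (simp add: matrix_vector_mult_def map_matrix_def vector_scalar_mult_def)
  have Ax: "A *v x = - Im z *\<^sub>R y"
    using arg_cong[OF eq, of Re] Re by (simp add: vec_eq_iff matrix_vector_mult_def x_def y_def)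
  have Ay: "A *v y = Im z *\<^sub>R x"
    using arg_cong[OF eq, of Im] Re by (simp add: vec_eq_iff matrix_vector_mult_def x_def y_def)
  have "bounded_bilinear B" using B by (simp add: bilinear_conv_bounded_bilinear)
  then interpret B: bounded_bilinear B .
  have sum0: "B x (A *v x) + B y (A *v y) = 0"
    by (simp add: Ax Ay B.scaleR_right sym[of y x] B.minus_right)
  have nonneg: "B u (A *v u) \<ge> 0" for u
    using pos[of u] by (cases "u = 0") (auto simp: B.zero_left)
  have "x = 0" "y = 0"
    using sum0 pos[of x] pos[of y] nonneg[of x] nonneg[of y] by fastforce+
  then have "w = 0" by (simp add: vec_eq_iff x_def y_def complex_eq_iff)
  then show False using w by simp
qed

section \<open>Discrete summation by parts and Poincare inequality\<close>

lemma summation_by_parts: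
  fixes a g :: "nat \<Rightarrow> real"
  assumes "a 0 = 0" "a n = 0"
  shows "(\<Sum>k=1..<n. a k * (g (k + 1) - g k)) = - (\<Sum>k=1..n. (a k - a (k - 1)) * g k)"
proof -
  have "(\<Sum>k=1..<m. a k * (g (k + 1) - g k)) + (\<Sum>k=1..m. (a k - a (k - 1)) * g k) = a m * g m" for m
  proof (induction m)
    case (Suc m)
    have "(\<Sum>k=1..<Suc m. a k * (g (k + 1) - g k)) = (\<Sum>k=1..<m. a k * (g (k + 1) - g k)) + a m * (g (Suc m) - g m)"
      using assms(1) by (cases "m = 0") simp_all
    then show ?case using Suc by (simp add: algebra_simps)
  qed (simp add: assms)
  from this[of n] show ?thesis by (simp add: assms)
qed

text \<open>Each a\<open>\<^sub>k\<close> is 1/n times the sum of the first k strains, so Cauchy-Schwarz bounds its square by 1/n times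
  the sum of all squared strains; there are fewer than n such k.\<close>
lemma discrete_poincare:
  fixes a :: "nat \<Rightarrow> real"
  assumes n: "n > 0" and a0: "a 0 = 0"
  shows "(\<Sum>k=1..<n. (a k)\<^sup>2) \<le> (\<Sum>k=1..n. (strain (1 / real n) a k)\<^sup>2)" (is "_ \<le> ?S")
proof -
  have tele: "(\<Sum>j=1..k. strain (1 / real n) a j) = real n * a k" for k
    by (induction k) (simp_all add: a0 strain_def algebra_simps)
  have S: "?S \<ge> 0" by (intro sum_nonneg) simp
  have "(a k)\<^sup>2 \<le> ?S / n" if k: "k \<in> {1..<n}" for k
  proof -
    have "(real n * a k)\<^sup>2 \<le> (\<Sum>j=1..k. (strain (1 / real n) a j)\<^sup>2) * real k"
      using sum_squared_le_sum_of_squares[of "strain (1 / real n) a" "{1..k}"] unfolding tele by simp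
    also have "\<dots> \<le> ?S * real n"
      using k by (intro mult_mono sum_mono2 S) auto
    finally show ?thesis using n by (simp add: power2_eq_square field_simps)
  qed
  then have "(\<Sum>k=1..<n. (a k)\<^sup>2) \<le> of_nat (card {1..<n}) * (?S / n)"
    by (rule sum_bounded_above)
  also have "\<dots> \<le> real n * (?S / n)" using S by (intro mult_right_mono) auto
  finally show ?thesis using n by simp
qed

section \<open>The chain of oscillators\<close>

text \<open>The stress function and the end displacement P stay outside the parameters because they vary: the
  nonlinear chain, its translate to the origin and its linearization are chains with different ones.\<close>
locale oscillator_chain =
  fixes n :: nat and e :: "nat \<Rightarrow> 'm::finite" and h :: real
  assumes n2: "n \<ge> 2" and h: "h = 1 / real n" and e: "bij_betw e {1..<n} UNIV"
begin

lemma h_pos: "h > 0" using n2 h by simp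

lemma inv_e: "k \<in> {1..<n} \<Longrightarrow> the_inv_into {1..<n} e (e k) = k"
  using e by (auto simp: bij_betw_def intro: the_inv_into_f_f)

lemma all_sites: "(\<forall>j. Q j) \<longleftrightarrow> (\<forall>k\<in>{1..<n}. Q (e k))"
  using e by (auto simp: bij_betw_def) (metis UNIV_I imageE)

lemma site: obtains k where "k \<in> {1..<n}" "j = e k"
  using e unfolding bij_betw_def by blast

text \<open>Perturbations of the uniphase state vanish at both ends, so their displacements are taken
  with boundary value 0 in place of P.\<close>
abbreviation disp :: "real^('m + 'm) \<Rightarrow> nat \<Rightarrow> real" where
  "disp \<equiv> displacement n e 0"
abbreviation vel :: "real^('m + 'm) \<Rightarrow> nat \<Rightarrow> real" where
  "vel \<equiv> velocity n e"
abbreviation stretch :: "real^('m + 'm) \<Rightarrow> nat \<Rightarrow> real" where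
  "stretch x \<equiv> strain h (disp x)"

lemma linear_disp: "linear (\<lambda>x. disp x k)"
  by (rule linearI) (auto simp: displacement_def)
lemma linear_vel: "linear (\<lambda>x. vel x k)"
  by (rule linearI) (auto simp: velocity_def)
lemma linear_stretch: "linear (\<lambda>x. stretch x k)"
  unfolding strain_def
  by (rule linearI) (simp_all add: linear_add[OF linear_disp] linear_scale[OF linear_disp] algebra_simps)

lemma stretch_bound: "\<bar>stretch x k\<bar> \<le> 2 / h * norm x"
proof -
  have "\<bar>disp x j\<bar> \<le> norm x" for j
    using component_le_norm_cart by (auto simp: displacement_def)
  from this[of k] this[of "k - 1"] have "\<bar>disp x k - disp x (k - 1)\<bar> \<le> 2 * norm x" by linarith
  then show ?thesis using h_pos by (simp add: strain_def abs_mult divide_right_mono)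
qed

lemma chain_field_Inl: "chain_field n e h \<sigma> \<epsilon> P x $ Inl j = x $ Inr j"
  by (simp add: chain_field_def Let_def)

lemma chain_field_Inr:
  "k \<in> {1..<n} \<Longrightarrow> chain_field n e h \<sigma> \<epsilon> P x $ Inr (e k) =
     1 / h * \<sigma> (strain h (displacement n e P x) (k + 1)) - 1 / h * \<sigma> (strain h (displacement n e P x) k)
       + \<epsilon> / h\<^sup>2 * (vel x (k + 1) - 2 * vel x k + vel x (k - 1))"
  by (simp only: chain_field_def Let_def vec_lambda_beta sum.case inv_e)

text \<open>Since n h = 1, the uniphase state has strain P in every spring. A perturbation thus sees
  the chain with both ends at 0 and the stress \<open>\<sigma>\<close> measured from the point (P, \<open>\<sigma>\<close>(P)). This makes every
  statement about the equilibrium one about the field at 0, for an arbitrary stress function.\<close>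
lemma chain_field_shift:
  "chain_field n e h \<sigma> \<epsilon> P x =
     chain_field n e h (\<lambda>d. \<sigma> (P + d) - \<sigma> P) \<epsilon> 0 (x - uniphase_state n e h P)"
proof -
  define w where "w = x - uniphase_state n e h P"
  have x: "x = uniphase_state n e h P + w" by (simp add: w_def)
  have u: "displacement n e P x k = real k * h * P + disp w k" if "k \<le> n" for k
    using that n2 h inv_e[of k] by (auto simp: x displacement_def uniphase_state_def)
  have s: "strain h (displacement n e P x) k = P + stretch w k" if "k \<in> {1..n}" for k
    using that h_pos by (auto simp: strain_def u of_nat_diff field_simps)
  have v: "vel x k = vel w k" for k by (simp add: x velocity_def uniphase_state_def)
  have "chain_field n e h \<sigma> \<epsilon> P x $ i = chain_field n e h (\<lambda>d. \<sigma> (P + d) - \<sigma> P) \<epsilon> 0 w $ i" for i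
  proof (cases i)
    case (Inl j)
    then show ?thesis by (simp add: chain_field_Inl x uniphase_state_def)
  next
    case (Inr j)
    obtain k where k: "k \<in> {1..<n}" "j = e k" by (rule site)
    then show ?thesis unfolding Inr k(2) chain_field_Inr[OF k(1)] v
      by (simp add: s algebra_simps)
  qed
  then show ?thesis by (simp add: vec_eq_iff w_def)
qed

text \<open>The polarization of V. The second sum compensates the viscosity, whatever the sign of \<open>\<epsilon>\<close>.\<close>
definition chain_form :: "real \<Rightarrow> real^('m + 'm) \<Rightarrow> real^('m + 'm) \<Rightarrow> real" where
  "chain_form \<epsilon> x y =
     (\<Sum>k=1..<n. disp x k * vel y k + disp y k * vel x k) + \<epsilon> * (\<Sum>k=1..n. stretch x k * stretch y k)"

lemma chain_form_sym: "chain_form \<epsilon> x y = chain_form \<epsilon> y x"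
  by (simp add: chain_form_def mult.commute add.commute)

lemma bilinear_chain_form: "bilinear (chain_form \<epsilon>)"
proof -
  have "linear (chain_form \<epsilon> x)" for x
    unfolding chain_form_def
    by (intro linearI) (simp_all add: linear_add[OF linear_disp] linear_scale[OF linear_disp]
      linear_add[OF linear_vel] linear_scale[OF linear_vel] linear_add[OF linear_stretch] linear_scale[OF linear_stretch]
      algebra_simps sum.distrib sum_distrib_left)
  then show ?thesis using chain_form_sym[of \<epsilon>] by (auto simp: bilinear_def)
qed

text \<open>The right-hand side of the equation of motion is the difference quotient of the total
  stress g, elastic plus viscous. Summation by parts moves the difference onto the displacements, where it
  becomes the strain; the viscous part that appears is cancelled by the second sum of the form.\<close>
lemma chain_form_rate:
  "chain_form \<epsilon> w (chain_field n e h \<tau> \<epsilon> 0 w) =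
     (\<Sum>k=1..<n. (vel w k)\<^sup>2) - (\<Sum>k=1..n. stretch w k * \<tau> (stretch w k))"
proof -
  let ?F = "chain_field n e h \<tau> \<epsilon> 0 w"
  define g where "g k = \<tau> (stretch w k) + \<epsilon> * strain h (vel w) k" for k
  have dF: "disp ?F = vel w"
    by (auto simp: displacement_def velocity_def chain_field_Inl)
  have vF: "vel ?F k = (g (k + 1) - g k) / h" if "k \<in> {1..<n}" for k
  proof -
    have "vel ?F k = ?F $ Inr (e k)" using that by (simp add: velocity_def)
    then show ?thesis unfolding chain_field_Inr[OF that] using h_pos
      by (simp add: g_def strain_def[of h "vel w"] power2_eq_square field_simps)
  qed
  have "(\<Sum>k=1..<n. disp w k * vel ?F k) = (\<Sum>k=1..<n. disp w k * (g (k + 1) - g k)) / h"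
    unfolding sum_divide_distrib by (intro sum.cong) (simp_all add: vF)
  also have "\<dots> = - (\<Sum>k=1..n. stretch w k * g k)"
    by (subst summation_by_parts) (simp_all add: displacement_def[of n e 0 w 0] displacement_def[of n e 0 w n]
      strain_def sum_divide_distrib)
  also have "\<dots> = - (\<Sum>k=1..n. stretch w k * \<tau> (stretch w k)) - \<epsilon> * (\<Sum>k=1..n. stretch w k * stretch ?F k)"
    by (simp add: g_def dF sum_distrib_left sum.distrib algebra_simps)
  finally show ?thesis
    by (simp add: chain_form_def sum.distrib dF power2_eq_square)
qed

text \<open>The square of a norm on the state space, kinetic plus elastic part. It serves to compare
  the form with its rate.\<close>
definition chain_norm2 :: "real^('m + 'm) \<Rightarrow> real" where
  "chain_norm2 w = (\<Sum>k=1..<n. (vel w k)\<^sup>2) + (\<Sum>k=1..n. (stretch w k)\<^sup>2)"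

lemma poincare_chain: "(\<Sum>k=1..<n. (disp w k)\<^sup>2) \<le> (\<Sum>k=1..n. (stretch w k)\<^sup>2)"
  unfolding h using n2 by (intro discrete_poincare) (auto simp: displacement_def)

lemma chain_norm2_pos:
  assumes "w \<noteq> 0" shows "chain_norm2 w > 0"
proof (rule ccontr)
  assume "\<not> chain_norm2 w > 0"
  moreover have nn: "(\<Sum>k=1..<n. (vel w k)\<^sup>2) \<ge> 0" "(\<Sum>k=1..<n. (disp w k)\<^sup>2) \<ge> 0" by (intro sum_nonneg; simp)+
  ultimately have "(\<Sum>k=1..<n. (vel w k)\<^sup>2) = 0" "(\<Sum>k=1..<n. (disp w k)\<^sup>2) = 0"
    using poincare_chain[of w] unfolding chain_norm2_def by linarith+
  then have "\<forall>k\<in>{1..<n}. vel w k = 0 \<and> disp w k = 0"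
    by (simp add: sum_nonneg_eq_0_iff)
  then have "\<forall>k\<in>{1..<n}. w $ Inr (e k) = 0 \<and> w $ Inl (e k) = 0"
    by (auto simp: displacement_def velocity_def)
  then have "\<forall>j. w $ Inr j = 0 \<and> w $ Inl j = 0" using all_sites[of "\<lambda>j. w $ Inr j = 0 \<and> w $ Inl j = 0"] by simp
  then have "w $ i = 0" for i by (cases i) auto
  then show False using assms by (simp add: vec_eq_iff)
qed

lemma chain_form_le: "chain_form \<epsilon> w w \<le> (1 + \<bar>\<epsilon>\<bar>) * chain_norm2 w"
proof -
  have "(\<Sum>k=1..<n. disp w k * vel w k + disp w k * vel w k) \<le> (\<Sum>k=1..<n. (disp w k)\<^sup>2 + (vel w k)\<^sup>2)"
    using sum_squares_bound by (intro sum_mono) (simp add: mult_2[symmetric] mult.assoc[symmetric])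
  also have "\<dots> \<le> chain_norm2 w"
    using poincare_chain[of w] by (simp add: sum.distrib chain_norm2_def)
  finally have 1: "(\<Sum>k=1..<n. disp w k * vel w k + disp w k * vel w k) \<le> chain_norm2 w" .
  have "(\<Sum>k=1..n. stretch w k * stretch w k) \<ge> 0" by (intro sum_nonneg) simp
  moreover have "(\<Sum>k=1..n. stretch w k * stretch w k) \<le> chain_norm2 w"
    unfolding chain_norm2_def by (simp add: power2_eq_square sum_nonneg)
  ultimately have "\<epsilon> * (\<Sum>k=1..n. stretch w k * stretch w k) \<le> \<bar>\<epsilon>\<bar> * chain_norm2 w"
    by (intro mult_mono) auto
  with 1 show ?thesis unfolding chain_form_def by (simp add: algebra_simps)
qed

lemma chain_form_rate_ge:
  assumes "\<And>k. k \<in> {1..n} \<Longrightarrow> stretch w k * \<tau> (stretch w k) \<le> - \<gamma> * (stretch w k)\<^sup>2"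
  shows "chain_form \<epsilon> w (chain_field n e h \<tau> \<epsilon> 0 w) \<ge> min 1 \<gamma> * chain_norm2 w"
proof -
  have "(\<Sum>k=1..n. stretch w k * \<tau> (stretch w k)) \<le> (\<Sum>k=1..n. - \<gamma> * (stretch w k)\<^sup>2)"
    using assms by (intro sum_mono) auto
  also have "\<dots> = - \<gamma> * (\<Sum>k=1..n. (stretch w k)\<^sup>2)" by (simp add: sum_distrib_left sum_negf)
  finally have "chain_form \<epsilon> w (chain_field n e h \<tau> \<epsilon> 0 w) \<ge>
      1 * (\<Sum>k=1..<n. (vel w k)\<^sup>2) + \<gamma> * (\<Sum>k=1..n. (stretch w k)\<^sup>2)"
    by (simp add: chain_form_rate)
  moreover have "min 1 \<gamma> * (\<Sum>k=1..<n. (vel w k)\<^sup>2) \<le> 1 * (\<Sum>k=1..<n. (vel w k)\<^sup>2)"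
      "min 1 \<gamma> * (\<Sum>k=1..n. (stretch w k)\<^sup>2) \<le> \<gamma> * (\<Sum>k=1..n. (stretch w k)\<^sup>2)"
    by (intro mult_right_mono sum_nonneg; simp)+
  ultimately show ?thesis by (simp add: chain_norm2_def distrib_left)
qed

text \<open>Equal displacements with equal, large velocities s: the term linear in s outweighs the
  possibly negative strain term, which is independent of s.\<close>
lemma chain_form_positive_somewhere: "\<exists>w. chain_form \<epsilon> w w > 0"
proof -
  define D where "D = (\<Sum>k=1..n. (stretch (\<chi> i. case i of Inl j \<Rightarrow> 1 | Inr j \<Rightarrow> 0) k)\<^sup>2)"
  define s where "s = \<bar>\<epsilon>\<bar> * D + 1"
  define w :: "real^('m + 'm)" where "w = (\<chi> i. case i of Inl j \<Rightarrow> 1 | Inr j \<Rightarrow> s)"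
  have D: "D \<ge> 0" unfolding D_def by (intro sum_nonneg) simp
  then have s: "s > 0" by (simp add: s_def add_nonneg_pos)
  have "disp w = disp (\<chi> i. case i of Inl j \<Rightarrow> 1 | Inr j \<Rightarrow> 0)"
    by (auto simp: displacement_def w_def)
  then have stretch: "(\<Sum>k=1..n. stretch w k * stretch w k) = D" by (simp add: D_def power2_eq_square)
  have "(\<Sum>k=1..<n. disp w k * vel w k + disp w k * vel w k) = (\<Sum>k=1..<n. 2 * s)"
    by (intro sum.cong) (auto simp: w_def displacement_def velocity_def)
  also have "\<dots> = real (n - 1) * (2 * s)" by simp
  also have "\<dots> \<ge> 1 * (2 * s)" using n2 s by (intro mult_right_mono) auto
  finally have "chain_form \<epsilon> w w \<ge> 2 * s + \<epsilon> * D" unfolding chain_form_def stretch by simp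
  moreover have "- (\<epsilon> * D) \<le> \<bar>\<epsilon>\<bar> * D" using mult_right_mono[OF abs_ge_minus_self[of \<epsilon>] D] by simp
  moreover have "\<bar>\<epsilon>\<bar> * D \<ge> 0" using D by simp
  ultimately have "chain_form \<epsilon> w w > 0" unfolding s_def by argo
  then show ?thesis ..
qed

text \<open>The only nonlinear ingredient of the field is the stress, so the linearization is again the field
  of a chain, with linear stress.\<close>
lemma chain_field_has_derivative_0:
  assumes \<tau>: "(\<tau> has_real_derivative c) (at 0)"
  shows "(chain_field n e h \<tau> \<epsilon> 0 has_derivative chain_field n e h (\<lambda>d. c * d) \<epsilon> 0) (at 0)"
proof -
  have lin: "(f has_derivative f) (at 0)" if "linear f" for f :: "real^('m + 'm) \<Rightarrow> real"
    using that by (simp add: linear_conv_bounded_linear bounded_linear_imp_has_derivative)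
  have str: "((\<lambda>x. \<tau> (stretch x k)) has_derivative (\<lambda>x. c * stretch x k)) (at 0)" for k
    by (rule has_derivative_compose[OF lin[OF linear_stretch]])
      (use \<tau> in \<open>simp add: linear_0[OF linear_stretch] has_field_derivative_def\<close>)
  have "((\<lambda>x. chain_field n e h \<tau> \<epsilon> 0 x $ i) has_derivative
      (\<lambda>x. chain_field n e h (\<lambda>d. c * d) \<epsilon> 0 x $ i)) (at 0)" for i
  proof (cases i)
    case (Inl j)
    then show ?thesis unfolding Inl chain_field_Inl by (intro lin linearI) auto
  next
    case (Inr j)
    obtain k where k: "k \<in> {1..<n}" "j = e k" by (rule site)
    show ?thesis unfolding Inr k(2) chain_field_Inr[OF k(1)]
      by (intro has_derivative_add has_derivative_diff has_derivative_mult_right str lin linear_vel)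
  qed
  then show ?thesis
    by (subst has_derivative_componentwise_within) (simp add: Basis_vec_def inner_axis)
qed

lemma chain_field_lipschitz:
  assumes \<tau>: "C-lipschitz_on {-\<rho>..\<rho>} \<tau>" and \<rho>: "\<rho> > 0"
  shows "\<exists>L. L-lipschitz_on (cball 0 (\<rho> * h / 2)) (chain_field n e h \<tau> \<epsilon> 0)"
proof (rule lipschitz_on_componentwise)
  let ?X = "cball 0 (\<rho> * h / 2) :: (real^('m + 'm)) set"
  have lin: "\<exists>K. K-lipschitz_on X f" if "linear f" for f :: "real^('m + 'm) \<Rightarrow> real" and X
    using that bounded_linear.lipschitz_boundE by (metis linear_conv_bounded_linear)
  have scale: "\<exists>K. K-lipschitz_on X (\<lambda>x. c * f x)" if "\<exists>K. K-lipschitz_on X f"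
    for f :: "real^('m + 'm) \<Rightarrow> real" and X c
    using that lipschitz_on_cmult_real by blast
  have add: "\<exists>K. K-lipschitz_on X (\<lambda>x. f x + g x)" if "\<exists>K. K-lipschitz_on X f" "\<exists>K. K-lipschitz_on X g"
    for f g :: "real^('m + 'm) \<Rightarrow> real" and X
    using that lipschitz_on_add by blast
  have diff: "\<exists>K. K-lipschitz_on X (\<lambda>x. f x - g x)" if "\<exists>K. K-lipschitz_on X f" "\<exists>K. K-lipschitz_on X g"
    for f g :: "real^('m + 'm) \<Rightarrow> real" and X
    using that lipschitz_on_diff by blast
  have str: "\<exists>K. K-lipschitz_on ?X (\<lambda>x. \<tau> (stretch x k))" for k
  proof -
    obtain K where K: "K-lipschitz_on ?X (\<lambda>x. stretch x k)" using lin[OF linear_stretch] by blast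
    have "\<bar>stretch x k\<bar> \<le> \<rho>" if "x \<in> ?X" for x
    proof -
      have "\<bar>stretch x k\<bar> \<le> 2 / h * norm x" by (rule stretch_bound)
      also have "\<dots> \<le> 2 / h * (\<rho> * h / 2)" using that h_pos by (intro mult_left_mono) auto
      finally show ?thesis using h_pos by simp
    qed
    then have "(\<lambda>x. stretch x k) ` ?X \<subseteq> {-\<rho>..\<rho>}" by (force simp: abs_le_iff)
    then show ?thesis
      using lipschitz_on_compose2[OF K lipschitz_on_subset[OF \<tau>]] by blast
  qed
  fix i
  show "\<exists>K. K-lipschitz_on ?X (\<lambda>x. chain_field n e h \<tau> \<epsilon> 0 x $ i)"
  proof (cases i)
    case (Inl j)
    then show ?thesis unfolding Inl chain_field_Inl by (intro lin linearI) auto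
  next
    case (Inr j)
    obtain k where k: "k \<in> {1..<n}" "j = e k" by (rule site)
    show ?thesis unfolding Inr k(2) chain_field_Inr[OF k(1)]
      by (intro add diff scale str lin linear_vel)
  qed
qed

end

section \<open>The uniphase state in the softening range\<close>

theorem theorem3p2:
  fixes n :: nat and h\<^sub>1 P \<epsilon> :: real
    and \<sigma> \<sigma>' :: "real \<Rightarrow> real"
    and \<alpha>l \<alpha>u \<beta>l \<beta>u :: real
    and e :: "nat \<Rightarrow> 'm::finite"
  assumes "n \<ge> 2" and "h\<^sub>1 = 1 / real n"
    and "bij_betw e {1..<n} (UNIV :: 'm set)"
    and "P > 0"
    and "\<And>\<xi>. (\<sigma> has_real_derivative \<sigma>' \<xi>) (at \<xi>)"
    and "continuous_on UNIV \<sigma>'"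
    and "\<sigma> 0 = 0"
    and "\<And>\<xi>. \<xi> > 0 \<Longrightarrow> \<sigma> \<xi> > 0"
    and "\<And>\<xi>. \<xi> < 0 \<Longrightarrow> \<sigma> \<xi> < 0"
    and "0 < \<alpha>l" and "\<alpha>l < \<alpha>u" and "\<alpha>u < \<beta>l" and "\<beta>l < \<beta>u"
    and "\<And>\<xi>. \<xi> \<in> {..<\<alpha>u} \<union> {\<beta>l<..} \<Longrightarrow> \<sigma>' \<xi> > 0"
    and "\<And>\<xi>. \<xi> \<in> {\<alpha>u<..<\<beta>l} \<Longrightarrow> \<sigma>' \<xi> < 0"
    and "\<sigma> \<alpha>l = \<sigma> \<beta>l" and "\<sigma> \<alpha>u = \<sigma> \<beta>u"
    and "P \<in> {\<alpha>u<..<\<beta>l}"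
  shows "hyperbolic_equilibrium (chain_field n e h\<^sub>1 \<sigma> \<epsilon> P) (uniphase_state n e h\<^sub>1 P)
       \<and> unstable (chain_field n e h\<^sub>1 \<sigma> \<epsilon> P) (uniphase_state n e h\<^sub>1 P)"
proof -
  interpret oscillator_chain n e h\<^sub>1 by unfold_locales fact+
  define p where "p = uniphase_state n e h\<^sub>1 P"
  define c where "c = \<sigma>' P"
  define \<tau> where "\<tau> d = \<sigma> (P + d) - \<sigma> P" for d
  let ?F = "chain_field n e h\<^sub>1 \<sigma> \<epsilon> P" and ?G = "chain_field n e h\<^sub>1 \<tau> \<epsilon> 0"
  let ?D = "chain_field n e h\<^sub>1 (\<lambda>d. c * d) \<epsilon> 0"
  have c: "c < 0" unfolding c_def by (rule assms) fact
  have \<tau>0: "\<tau> 0 = 0" by (simp add: \<tau>_def)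
  have d\<tau>: "(\<tau> has_real_derivative \<sigma>' (P + d)) (at d)" for d
    unfolding \<tau>_def using assms(5)[of "P + d"]
    by (auto intro!: derivative_eq_intros DERIV_chain2[where g = "\<lambda>d. P + d"])
  have F: "?F = (\<lambda>x. ?G (x - p))"
    unfolding p_def \<tau>_def using chain_field_shift by blast
  have dF: "(?F has_derivative ?D) (at p)"
  proof -
    have "((\<lambda>x. ?G (x - p)) has_derivative (\<lambda>w. ?D w)) (at p)"
      by (rule has_derivative_compose[where f = "\<lambda>x. x - p" and f' = "\<lambda>w. w"])
        (use chain_field_has_derivative_0[of \<tau> c] d\<tau>[of 0] in \<open>auto intro!: derivative_eq_intros simp: c_def\<close>)
    then show ?thesis by (simp add: F)
  qed
  have hyp: "hyperbolic_equilibrium ?F p"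
    unfolding hyperbolic_equilibrium_def
  proof (intro conjI allI impI)
    have "?G 0 $ i = 0" for i
    proof (cases i)
      case (Inl j)
      then show ?thesis by (simp add: chain_field_Inl)
    next
      case (Inr j)
      obtain k where k: "k \<in> {1..<n}" "j = e k" by (rule site)
      show ?thesis unfolding Inr k(2) chain_field_Inr[OF k(1)]
        by (simp add: linear_0[OF linear_stretch] linear_0[OF linear_vel] \<tau>0)
    qed
    then show "?F p = 0" by (simp add: F vec_eq_iff)
    show diff: "?F differentiable at p" using dF by (auto simp: differentiable_def)
    have J: "(*v) (jacobian ?F (at p)) = ?D"
      using diff dF jacobian_works has_derivative_unique by blast
    fix z assume z: "complex_eigenvalue (jacobian ?F (at p)) z"
    show "Re z \<noteq> 0"
    proof (rule no_imaginary_eigenvalue[OF bilinear_chain_form chain_form_sym _ z])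
      fix w :: "real^('m + 'm)" assume "w \<noteq> 0"
      then have "0 < min 1 (-c) * chain_norm2 w" using c by (intro mult_pos_pos chain_norm2_pos) auto
      also have "\<dots> \<le> chain_form \<epsilon> w (?D w)"
        by (rule chain_form_rate_ge) (simp add: power2_eq_square)
      finally show "chain_form \<epsilon> w (jacobian ?F (at p) *v w) > 0" by (simp add: J)
    qed
  qed
  have unst: "unstable ?F p"
  proof -
    obtain \<rho> where \<rho>: "\<rho> > 0" and neg: "\<And>d. \<bar>d\<bar> \<le> \<rho> \<Longrightarrow> d * \<tau> d \<le> c / 2 * d\<^sup>2"
      using negative_derivative_at_0_bound[of \<tau> c] d\<tau>[of 0] c \<tau>0 by (auto simp: c_def)
    \<comment> \<open>on this ball all strains of the perturbation are at most \<open>\<rho>\<close>, where the bound on \<open>\<tau>\<close> applies\<close>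
    define r where "r = \<rho> * h\<^sub>1 / 2"
    have r: "r > 0" using \<rho> h_pos by (simp add: r_def)
    have "continuous_on {-\<rho>..\<rho>} (\<lambda>d. \<sigma>' (P + d))"
      by (intro continuous_on_compose2[OF assms(6)] continuous_intros) auto
    then obtain C where "C-lipschitz_on {-\<rho>..\<rho>} \<tau>"
      using lipschitz_on_interval_if_C1[OF d\<tau>] by blast
    then obtain L where L: "L-lipschitz_on (cball 0 r) ?G"
      using chain_field_lipschitz \<rho> unfolding r_def by blast
    have lip: "L-lipschitz_on (cball p r) ?F"
      unfolding F
    proof (rule lipschitz_onI)
      fix x y assume "x \<in> cball p r" "y \<in> cball p r"
      then have "x - p \<in> cball 0 r" "y - p \<in> cball 0 r"
        by (auto simp: dist_norm norm_minus_commute)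
      from lipschitz_onD[OF L this] show "dist (?G (x - p)) (?G (y - p)) \<le> L * dist x y"
        by (simp add: dist_norm)
    qed (rule lipschitz_on_nonneg[OF L])
    obtain v where v: "chain_form \<epsilon> v v > 0" using chain_form_positive_somewhere by blast
    define m where "m = min 1 (-c/2)"
    have m: "m > 0" using c by (simp add: m_def)
    show ?thesis
    proof (rule quadratic_growth_imp_unstable[OF bilinear_chain_form chain_form_sym r lip _ _ v])
      show "m / (1 + \<bar>\<epsilon>\<bar>) > 0" using m by (simp add: add_pos_nonneg)
      fix x assume x: "x \<in> cball p r"
      define w where "w = x - p"
      have "norm w \<le> r" using x by (simp add: w_def dist_norm norm_minus_commute)
      have small: "\<bar>stretch w k\<bar> \<le> \<rho>" for k
      proof -
        have "\<bar>stretch w k\<bar> \<le> 2 / h\<^sub>1 * norm w" by (rule stretch_bound)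
        also have "\<dots> \<le> 2 / h\<^sub>1 * r" using \<open>norm w \<le> r\<close> h_pos by (intro mult_left_mono) auto
        finally show ?thesis using h_pos by (simp add: r_def)
      qed
      have "m / (1 + \<bar>\<epsilon>\<bar>) * chain_form \<epsilon> w w \<le> m / (1 + \<bar>\<epsilon>\<bar>) * ((1 + \<bar>\<epsilon>\<bar>) * chain_norm2 w)"
        using m by (intro mult_left_mono chain_form_le) auto
      also have "\<dots> = m * chain_norm2 w" by (simp add: add_pos_nonneg less_imp_neq[symmetric])
      also have "\<dots> \<le> chain_form \<epsilon> w (?G w)"
        unfolding m_def using neg[OF small] by (intro chain_form_rate_ge) simp
      finally show "m / (1 + \<bar>\<epsilon>\<bar>) * chain_form \<epsilon> (x - p) (x - p) \<le> chain_form \<epsilon> (x - p) (?F x)"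
        by (simp add: F w_def)
    qed
  qed
  show ?thesis using hyp unst by (simp add: p_def)
qed

end
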